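(* Let $k>1$ be an integer, and let $f_k(m)=\max\{\chi_{\ell}(G^k): G \text{ a graph with } \chi(G^k)=m\}$. If $k$ is even, then $f_k(m)<m^2$. If $k$ is odd, then $f_k(m)<m^3$.
   Context: Graphs are finite and simple. The $k$th power $G^k$ of a graph $G$ is the graph on the same vertex set in which two distinct vertices $u,v$ are adjacent if and only if the distance from $u$ to $v$ in $G$ is at most $k$. $\chi$ denotes the chromatic number. The list-chromatic number $\chi_{\ell}(G)$ is the least $t$ such that for any assignment of lists of size $t$ to the vertices of $G$ there is a proper coloring of $V(G)$ in which the color of each vertex belongs to that vertex's list. Here $m$ denotes a positive integer.
   Formalization: The formal theorem assumes m > 1: for m = 1 the power G^k is edgeless, so f_k(1) = 1, which is not less than 1^2 or 1^3. Vertices and colors are taken to be natural numbers, which loses nothing for finite graphs. *)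

theory Defs
  imports "Graph_Theory.Pair_Digraph" "Graph_Theory.Shortest_Path"
begin

text \<open>
  A finite simple graph is a \<open>pair_graph\<close>, i.e. a finite, loop-free, symmetric digraph whose arcs
  are ordered pairs of vertices; an undirected edge uv is the pair of arcs (u,v), (v,u).
\<close>

text \<open>
  The infimum of an empty set of walks is \<open>\<infinity>\<close>, so vertices in different components are
  at infinite distance.
\<close>

definition graph_dist :: "'a pair_pre_digraph \<Rightarrow> 'a \<Rightarrow> 'a \<Rightarrow> ereal" where
  "graph_dist G u v = wf_digraph.\<mu> (with_proj G) (\<lambda>_. 1) u v"

definition graph_power :: "'a pair_pre_digraph \<Rightarrow> nat \<Rightarrow> 'a pair_pre_digraph" where
  "graph_power G k =
     \<lparr> pverts = pverts G,
       parcs = {(u, v). u \<in> pverts G \<and> v \<in> pverts G \<and> u \<noteq> v \<and>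
                        graph_dist G u v \<le> ereal (real k)} \<rparr>"

definition proper_coloring :: "'a pair_pre_digraph \<Rightarrow> ('a \<Rightarrow> nat) \<Rightarrow> bool" where
  "proper_coloring G c \<longleftrightarrow> (\<forall>(u, v) \<in> parcs G. c u \<noteq> c v)"

definition chromatic_number :: "'a pair_pre_digraph \<Rightarrow> nat" where
  "chromatic_number G =
     (LEAST n. \<exists>c. proper_coloring G c \<and> (\<forall>v \<in> pverts G. c v < n))"

text \<open>
  Taking natural numbers as colors loses no generality: on a finite graph, the union of
  finitely many finite lists can be relabelled injectively by natural numbers.
\<close>

definition choosable :: "'a pair_pre_digraph \<Rightarrow> nat \<Rightarrow> bool" where
  "choosable G t \<longleftrightarrow>
     (\<forall>L :: 'a \<Rightarrow> nat set.
        (\<forall>v \<in> pverts G. finite (L v) \<and> card (L v) = t) \<longrightarrow>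
        (\<exists>c. proper_coloring G c \<and> (\<forall>v \<in> pverts G. c v \<in> L v)))"

definition list_chromatic_number :: "'a pair_pre_digraph \<Rightarrow> nat" where
  "list_chromatic_number G = (LEAST t. choosable G t)"

text \<open>
  Every finite graph is isomorphic to one whose vertices are natural numbers, so it suffices to
  let \<open>G\<close> range over the latter. \<open>Max\<close> is only meaningful on finite nonempty sets.
\<close>

definition power_list_chromatic_numbers :: "nat \<Rightarrow> nat \<Rightarrow> nat set" where
  "power_list_chromatic_numbers k m =
     {list_chromatic_number (graph_power G k) | G :: nat pair_pre_digraph.
        pair_graph G \<and> chromatic_number (graph_power G k) = m}"

definition power_choice_max :: "nat \<Rightarrow> nat \<Rightarrow> nat" where
  "power_choice_max k m = Max (power_list_chromatic_numbers k m)"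

end

theory Submission
  imports Defs
begin

text \<open>
  With \<open>r = k div 2\<close>, every ball of radius \<open>r\<close> is a clique of \<open>G\<^sup>k\<close>, hence has at most \<open>m\<close>
  vertices; as \<open>2 \<le> k\<close>, so is every ball of radius 1. A ball of radius \<open>k\<close> around \<open>v\<close> is a union of
  at most \<open>m\<close> balls of radius \<open>r\<close> (even \<open>k\<close>) or \<open>r + 1\<close> (odd \<open>k\<close>), all of which contain \<open>v\<close>.
  So the maximum degree of \<open>G\<^sup>k\<close> is at most \<open>m (m - 1)\<close>, respectively \<open>m (m\<^sup>2 - 1)\<close>, and greedy
  colouring from the lists needs only one colour more than that.
\<close>

section \<open>Greedy list colouring\<close>

text \<open>The vertex added last has fewer neighbours than colours in its list, so some listed
  colour is free.\<close>

lemma greedy_list_coloring: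
  fixes R :: "'a rel" and L :: "'a \<Rightarrow> 'b set"
  assumes "finite S" and "sym R" and "irrefl R"
    and deg: "\<And>v. v \<in> S \<Longrightarrow> finite (R `` {v}) \<and> card (R `` {v}) < card (L v)"
  shows "\<exists>c. (\<forall>(u, v) \<in> R. u \<in> S \<longrightarrow> v \<in> S \<longrightarrow> c u \<noteq> c v) \<and> (\<forall>v \<in> S. c v \<in> L v)"
  using \<open>finite S\<close> deg
proof (induction S)
  case empty
  then show ?case by simp
next
  case (insert x S)
  then obtain c where c: "\<forall>(u, v) \<in> R. u \<in> S \<longrightarrow> v \<in> S \<longrightarrow> c u \<noteq> c v" "\<forall>v \<in> S. c v \<in> L v"
    by auto
  have fin: "finite (R `` {x})" and lt: "card (R `` {x}) < card (L x)"
    using insert.prems by auto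
  have "card (c ` (R `` {x})) < card (L x)"
    using card_image_le[OF fin, of c] lt by linarith
  \<comment> \<open>The image includes arbitrary values of \<open>c\<close> at neighbours outside
    \<open>S\<close>. Avoiding these too is harmless, since the degree counts all of
    \<open>R\<close>.\<close>
  then obtain a where a: "a \<in> L x" "a \<notin> c ` (R `` {x})"
    using card_mono[of "c ` (R `` {x})" "L x"] fin by (meson finite_imageI leD subsetI)
  have ne: "c v \<noteq> a" if "(x, v) \<in> R \<or> (v, x) \<in> R" for v
    using that a(2) \<open>sym R\<close> by (auto dest: symD)
  have "\<forall>(u, v) \<in> R. u \<in> insert x S \<longrightarrow> v \<in> insert x S \<longrightarrow> (c(x := a)) u \<noteq> (c(x := a)) v"
  proof (intro ballI, clarify)
    fix u v
    assume uv: "(u, v) \<in> R" "u \<in> insert x S" "v \<in> insert x S" and eq: "(c(x := a)) u = (c(x := a)) v"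
    have "u \<noteq> v"
      using uv(1) \<open>irrefl R\<close> by (auto simp: irrefl_def)
    then consider "u = x" "v \<noteq> x" | "u \<noteq> x" "v = x" | "u \<noteq> x" "v \<noteq> x"
      by blast
    then show False
    proof cases
      case 1
      then show False using ne[of v] uv(1) eq by simp
    next
      case 2
      then show False using ne[of u] uv(1) eq by simp
    next
      case 3
      then show False using c(1) uv eq by auto
    qed
  qed
  moreover have "\<forall>v \<in> insert x S. (c(x := a)) v \<in> L v"
    using c(2) a(1) by auto
  ultimately show ?case by blast
qed

lemma (in pair_graph) list_chromatic_number_le_degree:
  assumes deg: "\<And>v. v \<in> pverts G \<Longrightarrow> card (parcs G `` {v}) \<le> d"
  shows "list_chromatic_number G \<le> Suc d"
  unfolding list_chromatic_number_def
proof (rule Least_le)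
  show "choosable G (Suc d)"
    unfolding choosable_def
  proof (intro allI impI)
    fix L :: "'a \<Rightarrow> nat set"
    assume L: "\<forall>v \<in> pverts G. finite (L v) \<and> card (L v) = Suc d"
    have "finite (parcs G `` {v})" for v
      using pair_finite_arcs by (rule finite_Image)
    moreover have "sym (parcs G)"
      using pair_sym_arcs by (simp add: symmetric_def)
    moreover have "irrefl (parcs G)"
      using pair_no_loops by (force simp: irrefl_def)
    ultimately obtain c where
      "\<forall>(u, v) \<in> parcs G. u \<in> pverts G \<longrightarrow> v \<in> pverts G \<longrightarrow> c u \<noteq> c v"
      "\<forall>v \<in> pverts G. c v \<in> L v"
      using greedy_list_coloring[of "pverts G" "parcs G" L] pair_finite_verts deg L
      by (auto simp: less_Suc_eq_le)
    then show "\<exists>c. proper_coloring G c \<and> (\<forall>v \<in> pverts G. c v \<in> L v)"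
      unfolding proper_coloring_def by (intro exI[of _ c]) (auto dest: in_arcsD1 in_arcsD2)
  qed
qed

text \<open>An optimal colouring is injective on a clique.\<close>

lemma (in pair_graph) clique_le_chromatic_number:
  assumes "S \<subseteq> pverts G"
    and clique: "\<And>u v. u \<in> S \<Longrightarrow> v \<in> S \<Longrightarrow> u \<noteq> v \<Longrightarrow> (u, v) \<in> parcs G"
  shows "card S \<le> chromatic_number G"
proof -
  \<comment> \<open>The \<open>LEAST\<close> in \<open>chromatic_number\<close> is attained only if
    some colouring exists; numbering the vertices injectively supplies one.\<close>
  obtain f :: "'a \<Rightarrow> nat" and n where f: "f ` pverts G = {i. i < n}" "inj_on f (pverts G)"
    using finite_imp_inj_to_nat_seg[OF pair_finite_verts] by blast
  then have "proper_coloring G f \<and> (\<forall>v \<in> pverts G. f v < n)"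
    unfolding proper_coloring_def
    by (auto dest!: inj_onD dest: in_arcsD1 in_arcsD2 pair_no_loops)
  then have "\<exists>n c. proper_coloring G c \<and> (\<forall>v \<in> pverts G. c v < n)"
    by blast
  then obtain c where c: "proper_coloring G c" "\<forall>v \<in> pverts G. c v < chromatic_number G"
    unfolding chromatic_number_def using LeastI_ex by (smt (verit))
  have "inj_on c S"
    using c(1) clique unfolding proper_coloring_def inj_on_def by blast
  moreover have "c ` S \<subseteq> {..<chromatic_number G}"
    using c(2) assms(1) by auto
  ultimately show ?thesis
    using card_inj_on_le[of c S "{..<chromatic_number G}"] by simp
qed

section \<open>Balls in a graph\<close>

text \<open>The reflexive closure permits waiting in place, so its \<open>n\<close>-th power encodes
  "at most \<open>n\<close> steps", and its image of \<open>{v}\<close> is the ball of radius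
  \<open>n\<close> around a vertex \<open>v\<close>.\<close>

lemma mono_relpow_reflcl:
  assumes "m \<le> n"
  shows "(R\<^sup>=) ^^ m \<subseteq> (R\<^sup>=) ^^ n"
proof
  fix p assume p: "p \<in> (R\<^sup>=) ^^ m"
  have "Id \<subseteq> (R\<^sup>=) ^^ j" for j
    by (induction j) auto
  then have "p \<in> (R\<^sup>=) ^^ (m + (n - m))"
    unfolding relpow_add using p by (cases p) blast
  then show "p \<in> (R\<^sup>=) ^^ n"
    using assms by simp
qed

context pair_graph
begin

lemma sym_relpow_reflcl: "sym ((parcs G)\<^sup>= ^^ n)"
proof -
  have "sym ((parcs G)\<^sup>=)"
    using pair_sym_arcs by (auto simp: symmetric_def sym_def)
  then show ?thesis
  proof (induction n)
    case (Suc n)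
    then show ?case
      by (metis relpow.simps(2) relpow_commute converse_relcomp sym_conv_converse_eq)
  qed (simp add: sym_Id)
qed

lemma ball_subset_pverts:
  assumes "v \<in> pverts G"
  shows "((parcs G)\<^sup>= ^^ n) `` {v} \<subseteq> pverts G"
  using assms by (induction n) (auto dest: in_arcsD2)

lemma finite_ball:
  assumes "v \<in> pverts G"
  shows "finite (((parcs G)\<^sup>= ^^ n) `` {v})"
  using ball_subset_pverts[OF assms] pair_finite_verts by (rule finite_subset)

section \<open>Walks and distance\<close>

lemma awalk_imp_relpow:
  assumes "awalk u p v"
  shows "(u, v) \<in> (parcs G)\<^sup>= ^^ length p"
  using assms
proof (induction p arbitrary: u)
  case Nil
  then show ?case by (simp add: awalk_Nil_iff)
next
  case (Cons e p)
  then have "(u, snd e) \<in> (parcs G)\<^sup>=" "(snd e, v) \<in> (parcs G)\<^sup>= ^^ length p"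
    by (cases e; auto simp: awalk_Cons_iff)+
  then show ?case
    by (simp only: list.size add_Suc_right add_0_right) (rule relpow_Suc_I2)
qed

lemma relpow_imp_awalk:
  assumes "u \<in> pverts G" and "(u, v) \<in> (parcs G)\<^sup>= ^^ n"
  shows "\<exists>p. awalk u p v \<and> length p \<le> n"
  using assms
proof (induction n arbitrary: u)
  case 0
  then show ?case by (auto intro!: exI[of _ "[]"] simp: awalk_Nil_iff)
next
  case (Suc n)
  then obtain w where w: "(u, w) \<in> (parcs G)\<^sup>=" "(w, v) \<in> (parcs G)\<^sup>= ^^ n"
    by (meson relpow_Suc_D2)
  then have "w \<in> pverts G"
    using Suc.prems in_arcsD2 by auto
  then obtain p where p: "awalk w p v" "length p \<le> n"
    using Suc.IH w(2) by blast
  show ?case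
  \<comment> \<open>A waiting step contributes no arc, so the walk may be shorter than
    \<open>n\<close>.\<close>
  proof (cases "u = w")
    case True
    then show ?thesis using p by auto
  next
    case False
    then have "awalk u ((u, w) # p) v"
      using w(1) p(1) Suc.prems by (auto simp: awalk_Cons_iff)
    then show ?thesis using p(2) by (intro exI[of _ "(u, w) # p"]) simp
  qed
qed

lemma awalk_cost_one: "awalk_cost (\<lambda>_. 1) p = real (length p)"
  by (induction p) auto

text \<open>The hypothesis on \<open>u\<close> matters: outside \<open>pverts G\<close> the relation
  still contains \<open>(u, u)\<close>, while no walk starts at \<open>u\<close> and the distance is
  infinite.\<close>

lemma graph_dist_le_iff:
  assumes "u \<in> pverts G"
  shows "graph_dist G u v \<le> ereal (real k) \<longleftrightarrow> (u, v) \<in> (parcs G)\<^sup>= ^^ k"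
proof
  assume "graph_dist G u v \<le> ereal (real k)"
  \<comment> \<open>An infimum strictly below a bound has a witness below it; lengths are integers,
    so length below \<open>k + 1\<close> means at most \<open>k\<close>.\<close>
  also have "\<dots> < ereal (real (Suc k))"
    by simp
  finally obtain p where p: "awalk u p v" "length p < Suc k"
    unfolding graph_dist_def \<mu>_def awalk_cost_one by (auto simp: INF_less_iff)
  then show "(u, v) \<in> (parcs G)\<^sup>= ^^ k"
    using awalk_imp_relpow[OF p(1)] mono_relpow_reflcl[of "length p" k "parcs G"] by auto
next
  assume "(u, v) \<in> (parcs G)\<^sup>= ^^ k"
  then obtain p where p: "awalk u p v" "length p \<le> k"
    using relpow_imp_awalk assms by blast
  have "graph_dist G u v \<le> ereal (real (length p))"
    using min_cost_le_walk_cost[OF p(1), of "\<lambda>_. 1"] by (simp add: graph_dist_def awalk_cost_one)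
  also have "\<dots> \<le> ereal (real k)"
    using p(2) by simp
  finally show "graph_dist G u v \<le> ereal (real k)" .
qed

section \<open>Adjacency in graph powers\<close>

lemma pverts_graph_power [simp]: "pverts (graph_power G k) = pverts G"
  by (simp add: graph_power_def)

lemma parcs_graph_power_iff:
  assumes "u \<in> pverts G"
  shows "(u, v) \<in> parcs (graph_power G k) \<longleftrightarrow> u \<noteq> v \<and> (u, v) \<in> (parcs G)\<^sup>= ^^ k"
  using assms ball_subset_pverts[OF assms, of k]
  by (auto simp: graph_power_def graph_dist_le_iff)

lemma pair_graph_power: "pair_graph (graph_power G k)"
proof unfold_locales
  show "finite (pverts (graph_power G k))"
    using pair_finite_verts by simp
  have "parcs (graph_power G k) \<subseteq> pverts G \<times> pverts G"
    by (auto simp only: graph_power_def pair_pre_digraph.simps)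
  then show "finite (parcs (graph_power G k))"
    by (rule finite_subset) (simp add: pair_finite_verts)
  show "symmetric (graph_power G k)"
    unfolding symmetric_def with_proj_simps
  proof (rule symI)
    fix u v assume uv: "(u, v) \<in> parcs (graph_power G k)"
    then have "u \<in> pverts G" "v \<in> pverts G"
      by (simp_all add: graph_power_def)
    then show "(v, u) \<in> parcs (graph_power G k)"
      using uv symD[OF sym_relpow_reflcl, of u v k] by (simp only: parcs_graph_power_iff) blast
  qed
  fix e assume "e \<in> parcs (graph_power G k)"
  then show "fst e \<in> pverts (graph_power G k)" "snd e \<in> pverts (graph_power G k)" "fst e \<noteq> snd e"
    by (cases e; simp add: graph_power_def)+
qed

section \<open>Counting balls and bounding degrees in the power\<close>

lemma card_ball_le_chromatic_number:
  assumes "v \<in> pverts G" and "2 * r \<le> k"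
  shows "card (((parcs G)\<^sup>= ^^ r) `` {v}) \<le> chromatic_number (graph_power G k)"
proof -
  interpret P: pair_graph "graph_power G k"
    by (rule pair_graph_power)
  show ?thesis
  proof (rule P.clique_le_chromatic_number)
    show "((parcs G)\<^sup>= ^^ r) `` {v} \<subseteq> pverts (graph_power G k)"
      using ball_subset_pverts assms(1) by simp
  next
    fix x y
    assume xy: "x \<in> ((parcs G)\<^sup>= ^^ r) `` {v}" "y \<in> ((parcs G)\<^sup>= ^^ r) `` {v}" "x \<noteq> y"
    then have "(x, v) \<in> (parcs G)\<^sup>= ^^ r" "(v, y) \<in> (parcs G)\<^sup>= ^^ r"
      using symD[OF sym_relpow_reflcl] by blast+
    \<comment> \<open>Two points of the ball are joined through its centre.\<close>
    then have "(x, y) \<in> (parcs G)\<^sup>= ^^ (r + r)"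
      unfolding relpow_add by (rule relcompI)
    then have "(x, y) \<in> (parcs G)\<^sup>= ^^ k"
      using mono_relpow_reflcl[of "r + r" k "parcs G"] assms(2) by auto
    then show "(x, y) \<in> parcs (graph_power G k)"
      using xy ball_subset_pverts[OF assms(1), of r] by (subst parcs_graph_power_iff) auto
  qed
qed

text \<open>Union bound over the first \<open>r\<close> steps. Removing \<open>D\<close> from every
  small ball lets \<open>D = {v}\<close> save one point per ball; \<open>D = {}\<close> gives the
  plain product bound.\<close>

lemma card_ball_add_diff_le:
  assumes "v \<in> pverts G" and "card (((parcs G)\<^sup>= ^^ r) `` {v}) \<le> M"
    and "\<And>u. (v, u) \<in> (parcs G)\<^sup>= ^^ r \<Longrightarrow> card (((parcs G)\<^sup>= ^^ s) `` {u} - D) \<le> N"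
  shows "card (((parcs G)\<^sup>= ^^ (r + s)) `` {v} - D) \<le> M * N"
proof -
  let ?A = "((parcs G)\<^sup>= ^^ r) `` {v}"
  have eq: "((parcs G)\<^sup>= ^^ (r + s)) `` {v} - D = (\<Union>u \<in> ?A. ((parcs G)\<^sup>= ^^ s) `` {u} - D)"
    unfolding relpow_add by auto
  have "card (\<Union>u \<in> ?A. ((parcs G)\<^sup>= ^^ s) `` {u} - D)
      \<le> (\<Sum>u \<in> ?A. card (((parcs G)\<^sup>= ^^ s) `` {u} - D))"
    using finite_ball[OF assms(1)] by (rule card_UN_le)
  also have "\<dots> \<le> card ?A * N"
    using sum_bounded_above[of ?A "\<lambda>u. card (((parcs G)\<^sup>= ^^ s) `` {u} - D)" N] assms(3) by simp
  also have "\<dots> \<le> M * N"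
    using assms(2) by simp
  finally show ?thesis
    unfolding eq .
qed

text \<open>Since \<open>r \<le> s\<close>, the center \<open>v\<close> lies in all the balls of radius \<open>s\<close> that cover the ball of
  radius \<open>r + s\<close>.\<close>

lemma card_graph_power_nbhd_le:
  assumes "v \<in> pverts G" and "r \<le> s"
    and "card (((parcs G)\<^sup>= ^^ r) `` {v}) \<le> M"
    and "\<And>u. u \<in> pverts G \<Longrightarrow> card (((parcs G)\<^sup>= ^^ s) `` {u}) \<le> N"
  shows "card (parcs (graph_power G (r + s)) `` {v}) \<le> M * (N - 1)"
proof -
  have "card (((parcs G)\<^sup>= ^^ s) `` {u} - {v}) \<le> N - 1" if "(v, u) \<in> (parcs G)\<^sup>= ^^ r" for u
  proof -
    have "u \<in> pverts G"
      using that ball_subset_pverts[OF assms(1), of r] by auto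
    moreover have "(u, v) \<in> (parcs G)\<^sup>= ^^ s"
      using symD[OF sym_relpow_reflcl that] mono_relpow_reflcl[OF assms(2)] by blast
    ultimately show ?thesis
      using assms(4)[of u] by (simp add: card_Diff_singleton diff_le_mono)
  qed
  then have "card (((parcs G)\<^sup>= ^^ (r + s)) `` {v} - {v}) \<le> M * (N - 1)"
    by (rule card_ball_add_diff_le[OF assms(1,3)])
  moreover have "parcs (graph_power G (r + s)) `` {v} = ((parcs G)\<^sup>= ^^ (r + s)) `` {v} - {v}"
    using parcs_graph_power_iff[OF assms(1)] by auto
  ultimately show ?thesis
    by simp
qed

lemma list_chromatic_number_graph_power_even:
  assumes "chromatic_number (graph_power G (2 * r)) = m"
  shows "list_chromatic_number (graph_power G (2 * r)) \<le> Suc (m * (m - 1))"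
proof -
  interpret P: pair_graph "graph_power G (2 * r)"
    by (rule pair_graph_power)
  show ?thesis
  proof (rule P.list_chromatic_number_le_degree)
    fix v assume "v \<in> pverts (graph_power G (2 * r))"
    then show "card (parcs (graph_power G (2 * r)) `` {v}) \<le> m * (m - 1)"
      using card_graph_power_nbhd_le[of v r r m m] card_ball_le_chromatic_number[of _ r "2 * r"] assms
      by (simp add: mult_2)
  qed
qed

text \<open>A ball of radius \<open>r + 1\<close> need not be a clique of the power, as
  \<open>2 * (r + 1)\<close> exceeds the exponent. It is covered by the balls of radius
  \<open>r\<close> around the points of a unit ball, and \<open>r > 0\<close> makes the unit ball a
  clique as well, whence \<open>m * m\<close>.\<close>

lemma list_chromatic_number_graph_power_odd:
  assumes "chromatic_number (graph_power G (2 * r + 1)) = m" and "r > 0"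
  shows "list_chromatic_number (graph_power G (2 * r + 1)) \<le> Suc (m * (m * m - 1))"
proof -
  interpret P: pair_graph "graph_power G (2 * r + 1)"
    by (rule pair_graph_power)
  have ball: "card (((parcs G)\<^sup>= ^^ s) `` {u}) \<le> m" if "u \<in> pverts G" "s \<le> r" for u s
    using card_ball_le_chromatic_number[of u s "2 * r + 1"] assms(1) that by simp
  have ball_Suc: "card (((parcs G)\<^sup>= ^^ (1 + r)) `` {u}) \<le> m * m" if "u \<in> pverts G" for u
  proof -
    have "card (((parcs G)\<^sup>= ^^ r) `` {w} - {}) \<le> m" if "(u, w) \<in> (parcs G)\<^sup>= ^^ 1" for w
      using ball[of w r] ball_subset_pverts[OF \<open>u \<in> pverts G\<close>, of 1] that by auto
    then show ?thesis
      using card_ball_add_diff_le[of u 1 m r "{}" m] ball[of u 1] that assms(2) by simp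
  qed
  show ?thesis
  proof (rule P.list_chromatic_number_le_degree)
    fix v assume "v \<in> pverts (graph_power G (2 * r + 1))"
    \<comment> \<open>The smaller radius comes first: there are at most \<open>m\<close> covering
      balls, and their radius \<open>1 + r\<close> suffices to reach back to
      \<open>v\<close>.\<close>
    then have "card (parcs (graph_power G (r + (1 + r))) `` {v}) \<le> m * (m * m - 1)"
      by (intro card_graph_power_nbhd_le ball ball_Suc) auto
    then show "card (parcs (graph_power G (2 * r + 1)) `` {v}) \<le> m * (m * m - 1)"
      by (simp add: mult_2)
  qed
qed

end

section \<open>Complete graphs\<close>

text \<open>This keeps the set under \<open>Max\<close> nonempty. A complete graph equals each of
  its positive powers, so \<open>m\<close> vertices give chromatic number \<open>m\<close>.\<close>

lemma exists_chromatic_number_graph_power: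
  assumes "k > 0"
  shows "\<exists>G :: nat pair_pre_digraph. pair_graph G \<and> chromatic_number (graph_power G k) = m"
proof -
  define K :: "nat pair_pre_digraph"
    where "K = \<lparr>pverts = {..<m}, parcs = {(u, v). u < m \<and> v < m \<and> u \<noteq> v}\<rparr>"
  interpret pair_graph K
  proof
    show "finite (parcs K)"
      by (rule finite_subset[of _ "{..<m} \<times> {..<m}"]) (auto simp: K_def)
  qed (auto simp: K_def symmetric_def sym_def)
  interpret P: pair_graph "graph_power K k"
    by (rule pair_graph_power)
  have "(u, v) \<in> parcs (graph_power K k)" if "u < m" "v < m" "u \<noteq> v" for u v
    using that mono_relpow_reflcl[of 1 k "parcs K"] assms
    by (subst parcs_graph_power_iff) (auto simp: K_def)
  then have "card {..<m} \<le> chromatic_number (graph_power K k)"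
    by (intro P.clique_le_chromatic_number) (auto simp: K_def graph_power_def)
  moreover have "chromatic_number (graph_power K k) \<le> m"
    unfolding chromatic_number_def
    by (rule Least_le, rule exI[of _ "\<lambda>v. v"])
      (auto simp: proper_coloring_def graph_power_def K_def)
  ultimately show ?thesis
    using pair_graph by auto
qed

section \<open>Strictness of the bounds and existence of the maximum\<close>

theorem theorem4p1:
  fixes k m :: nat
  assumes "k > 1" and "m > 1"
  shows "finite (power_list_chromatic_numbers k m) \<and>
         power_list_chromatic_numbers k m \<noteq> {} \<and>
         (even k \<longrightarrow> power_choice_max k m < m ^ 2) \<and>
         (odd k \<longrightarrow> power_choice_max k m < m ^ 3)"
proof -
  let ?A = "power_list_chromatic_numbers k m"
  have even: "n < m ^ 2" if "even k" "n \<in> ?A" for n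
  proof -
    obtain r where "k = 2 * r"
      using \<open>even k\<close> by (elim evenE)
    then have "n \<le> Suc (m * (m - 1))"
      using \<open>n \<in> ?A\<close> pair_graph.list_chromatic_number_graph_power_even
      by (auto simp: power_list_chromatic_numbers_def)
    \<comment> \<open>The gap between \<open>m ^ 2\<close> and \<open>m * (m - 1) + 1\<close> is
      \<open>m - 1\<close>, positive only for \<open>m > 1\<close>; at \<open>m = 1\<close> both are
      1.\<close>
    moreover obtain j where "m = Suc (Suc j)"
      using \<open>m > 1\<close> less_imp_Suc_add[of 1 m] by auto
    ultimately show ?thesis
      by (simp add: power2_eq_square)
  qed
  have odd: "n < m ^ 3" if "odd k" "n \<in> ?A" for n
  proof -
    obtain r where "k = 2 * r + 1"
      using \<open>odd k\<close> by (elim oddE)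
    then have "n \<le> Suc (m * (m * m - 1))"
      using \<open>n \<in> ?A\<close> \<open>k > 1\<close> pair_graph.list_chromatic_number_graph_power_odd[of _ r m]
      by (auto simp: power_list_chromatic_numbers_def)
    \<comment> \<open>Again the gap to \<open>m ^ 3\<close> is \<open>m - 1\<close>.\<close>
    moreover obtain j where "m = Suc (Suc j)"
      using \<open>m > 1\<close> less_imp_Suc_add[of 1 m] by auto
    ultimately show ?thesis
      by (simp add: power3_eq_cube algebra_simps)
  qed
  have "finite ?A"
  proof (rule finite_subset)
    \<comment> \<open>The bounds on single members already give finiteness; the union covers both
      parities of \<open>k\<close>.\<close>
    show "?A \<subseteq> {..<m ^ 2} \<union> {..<m ^ 3}"
      using even odd by (cases "even k") auto
  qed simp
  moreover have "?A \<noteq> {}"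
    using exists_chromatic_number_graph_power[of k m] \<open>k > 1\<close>
    by (auto simp: power_list_chromatic_numbers_def)
  ultimately show ?thesis
    using even odd by (simp add: power_choice_max_def)
qed

end
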